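(* Let $FG$ be a fuzzy $T0L$ (resp. fuzzy $ET0L$) system with tables $\widetilde h_1,\dots,\widetilde h_m$ such that for each $i$ the restriction $f_i=f|_{J_i}$ is a constant $c_i\in[0,1]$. Then for every real $\lambda$ with $0\le\lambda<1$, the language $L(FG,\lambda)=\{x\in\Sigma^*\mid f_{FG}(x)>\lambda\}$ is a $T0L$ (resp. $ET0L$) language.
   Context: A finite substitution $h$ on a finite alphabet $\Sigma$ assigns to each letter $a$ a finite nonempty set $h(a)\subseteq\Sigma^*$, extended morphically, and is viewed as the set of productions $a\to u$, $u\in h(a)$. A fuzzy $T0L$ system is $FG=(\Sigma,\widetilde H,\omega,J,f)$: $\omega\in\Sigma^*$ is the axiom; $\widetilde H=\{\widetilde h_1,\dots,\widetilde h_m\}$ is a nonempty finite set of tables, where table $\widetilde h_i$ consists of the productions of a finite substitution $h_i$, each production carrying a label from $J_i$ (one label per production), the sets $J_i$ pairwise disjoint, $J=\bigcup_iJ_i$; and $f:J\to[0,1]$ gives the grade of each production. A derivation of $x$ is a sequence $\omega=x_0,x_1,\dots,x_n=x$ ($n\ge1$) where each $x_{k+1}$ is obtained from $x_k$ by choosing one table $h_i$ and simultaneously rewriting every letter occurrence of $x_k$ by some production of $h_i$ for that letter; its grade is the minimum of $f(r)$ over all productions $r$ applied. The grade of a string is $f_{FG}(\omega)=\max_{r\in J}f(r)$ and, for $x\ne\omega$, $f_{FG}(x)=$ the maximum grade over all derivations of $x$ (taken to be $0$ if $x$ has no derivation). A fuzzy $ET0L$ system is a fuzzy $T0L$ system together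 with a subset $\Delta\subseteq\Sigma$; its grade function $f_{FG}$ is that of the underlying fuzzy $T0L$ system. An (ordinary) $T0L$ language is one of the form $\{\omega\}\cup\bigcup_{n\ge1}\{x\in h_{i_1}\cdots h_{i_n}(\omega)\}$ for a finite alphabet, an axiom $\omega$ and a nonempty finite set of finite substitutions $h_1,\dots,h_m$; an $ET0L$ language is the intersection of such a set with $\Delta^*$ for some subset $\Delta$ of the alphabet.
   Formalization: In the T0L case the formal statement also assumes that L(FG,λ) is nonempty: if all c_i ≤ λ (e.g. one table a→a with c_1 = 0, λ = 0), L(FG,λ) is empty, whereas every T0L language contains its axiom. *)

theory Defs
  imports Complex_Main "HOL-Library.Disjoint_Sets"
begin

text \<open>
  Letters are elements of a type \<open>'a\<close>, alphabets are finite nonempty subsets of \<open>'a\<close>, and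
  \<open>lists \<Sigma>\<close> is the free monoid over \<open>\<Sigma>\<close>.  The type \<open>'a\<close> is arbitrary; an infinite \<open>'a\<close> leaves
  room for every finite alphabet.
\<close>

definition alphabet :: "'a set \<Rightarrow> bool" where
  "alphabet \<Sigma> \<longleftrightarrow> finite \<Sigma> \<and> \<Sigma> \<noteq> {}"

text \<open>A substitution is given by its values on letters; values outside \<open>\<Sigma>\<close> are irrelevant.\<close>

definition finite_substitution :: "'a set \<Rightarrow> ('a \<Rightarrow> 'a list set) \<Rightarrow> bool" where
  "finite_substitution \<Sigma> h \<longleftrightarrow> (\<forall>a\<in>\<Sigma>. finite (h a) \<and> h a \<noteq> {} \<and> h a \<subseteq> lists \<Sigma>)"

definition subst_word :: "('a \<Rightarrow> 'a list set) \<Rightarrow> 'a list \<Rightarrow> 'a list set" where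
  "subst_word h w = {concat us | us. list_all2 (\<lambda>a u. u \<in> h a) w us}"

definition subst_lang :: "('a \<Rightarrow> 'a list set) \<Rightarrow> 'a list set \<Rightarrow> 'a list set" where
  "subst_lang h L = (\<Union>w\<in>L. subst_word h w)"


section \<open>T0L and ET0L languages\<close>

definition T0L_system :: "'a set \<Rightarrow> ('a \<Rightarrow> 'a list set) set \<Rightarrow> 'a list \<Rightarrow> bool" where
  "T0L_system \<Sigma> H \<omega> \<longleftrightarrow>
     alphabet \<Sigma> \<and> finite H \<and> H \<noteq> {} \<and> (\<forall>h\<in>H. finite_substitution \<Sigma> h) \<and> \<omega> \<in> lists \<Sigma>"

text \<open>For \<open>hs = [h\<^sub>1, \<dots>, h\<^sub>n]\<close> the fold below is \<open>h\<^sub>1 (h\<^sub>2 (\<dots> (h\<^sub>n {\<omega>})))\<close>.\<close>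

definition T0L_generated :: "('a \<Rightarrow> 'a list set) set \<Rightarrow> 'a list \<Rightarrow> 'a list set" where
  "T0L_generated H \<omega> = {\<omega>} \<union> (\<Union>hs \<in> lists H - {[]}. foldr subst_lang hs {\<omega>})"

definition T0L_language :: "'a list set \<Rightarrow> bool" where
  "T0L_language L \<longleftrightarrow> (\<exists>\<Sigma> H \<omega>. T0L_system \<Sigma> H \<omega> \<and> L = T0L_generated H \<omega>)"

definition ET0L_language :: "'a list set \<Rightarrow> bool" where
  "ET0L_language L \<longleftrightarrow>
     (\<exists>\<Sigma> H \<omega> \<Delta>. T0L_system \<Sigma> H \<omega> \<and> \<Delta> \<subseteq> \<Sigma> \<and> L = T0L_generated H \<omega> \<inter> lists \<Delta>)"

text \<open>
  A T0L language contains its axiom, so the empty language is not T0L (it is ET0L).  This matters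
  for cuts of fuzzy systems, which are empty when no production grade exceeds the threshold.
\<close>

lemma T0L_language_nonempty: "T0L_language L \<Longrightarrow> L \<noteq> {}"
  by (auto simp: T0L_language_def T0L_generated_def)


section \<open>Fuzzy T0L and ET0L systems\<close>

text \<open>
  The tables are indexed by \<open>{1..ntables FG}\<close>.  A production \<open>a \<rightarrow> u\<close> is a pair \<open>(a, u)\<close>;
  \<open>prod_label FG i\<close> assigns to each production of table \<open>i\<close> its label in \<open>labels FG i\<close>.
  Neither injectivity nor surjectivity of this labelling is required.
\<close>

record ('a, 'l) fuzzy_T0L =
  letters :: "'a set"
  ntables :: nat
  table :: "nat \<Rightarrow> 'a \<Rightarrow> 'a list set"
  start :: "'a list"
  labels :: "nat \<Rightarrow> 'l set"
  prod_label :: "nat \<Rightarrow> 'a \<times> 'a list \<Rightarrow> 'l"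
  label_grade :: "'l \<Rightarrow> real"

definition tables :: "('a, 'l) fuzzy_T0L \<Rightarrow> nat set" where
  "tables FG = {1..ntables FG}"

definition productions :: "('a, 'l) fuzzy_T0L \<Rightarrow> nat \<Rightarrow> ('a \<times> 'a list) set" where
  "productions FG i = {(a, u). a \<in> letters FG \<and> u \<in> table FG i a}"

definition all_labels :: "('a, 'l) fuzzy_T0L \<Rightarrow> 'l set" where
  "all_labels FG = (\<Union>i\<in>tables FG. labels FG i)"

definition fuzzy_T0L_system :: "('a, 'l) fuzzy_T0L \<Rightarrow> bool" where
  "fuzzy_T0L_system FG \<longleftrightarrow>
     alphabet (letters FG) \<and>
     start FG \<in> lists (letters FG) \<and>
     ntables FG \<ge> 1 \<and>
     (\<forall>i\<in>tables FG. finite_substitution (letters FG) (table FG i)) \<and>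
     (\<forall>i\<in>tables FG. finite (labels FG i)) \<and>
     (\<forall>i\<in>tables FG. \<forall>p\<in>productions FG i. prod_label FG i p \<in> labels FG i) \<and>
     disjoint_family_on (labels FG) (tables FG) \<and>
     (\<forall>r\<in>all_labels FG. 0 \<le> label_grade FG r \<and> label_grade FG r \<le> 1)"

definition fuzzy_ET0L_system :: "('a, 'l) fuzzy_T0L \<Rightarrow> 'a set \<Rightarrow> bool" where
  "fuzzy_ET0L_system FG \<Delta> \<longleftrightarrow> fuzzy_T0L_system FG \<and> \<Delta> \<subseteq> letters FG"

text \<open>
  A derivation is recorded as the list of its steps; the step \<open>(i, ps)\<close> rewrites the \<open>k\<close>-th
  letter occurrence by the \<open>k\<close>-th production of \<open>ps\<close>, all taken from table \<open>i\<close>.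
\<close>

type_synonym 'a deriv = "(nat \<times> ('a \<times> 'a list) list) list"

fun derives :: "('a, 'l) fuzzy_T0L \<Rightarrow> 'a list \<Rightarrow> 'a deriv \<Rightarrow> 'a list \<Rightarrow> bool" where
  "derives FG x [] y \<longleftrightarrow> x = y"
| "derives FG x ((i, ps) # d) y \<longleftrightarrow>
     i \<in> tables FG \<and> set ps \<subseteq> productions FG i \<and> map fst ps = x \<and>
     derives FG (concat (map snd ps)) d y"

definition derivations :: "('a, 'l) fuzzy_T0L \<Rightarrow> 'a list \<Rightarrow> 'a deriv set" where
  "derivations FG x = {d. d \<noteq> [] \<and> derives FG (start FG) d x}"

definition applied_labels :: "('a, 'l) fuzzy_T0L \<Rightarrow> 'a deriv \<Rightarrow> 'l set" where
  "applied_labels FG d = (\<Union>(i, ps)\<in>set d. prod_label FG i ` set ps)"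

text \<open>
  No production at all is applied only in derivations from the empty axiom, which derives nothing
  but itself.  Such derivations do not enter \<open>string_grade\<close>, so both extrema below are always
  taken over finite nonempty sets (for \<open>all_labels\<close>, because alphabets are nonempty).
\<close>

definition deriv_grade :: "('a, 'l) fuzzy_T0L \<Rightarrow> 'a deriv \<Rightarrow> real" where
  "deriv_grade FG d = Min (label_grade FG ` applied_labels FG d)"

definition string_grade :: "('a, 'l) fuzzy_T0L \<Rightarrow> 'a list \<Rightarrow> real" where
  "string_grade FG x =
     (if x = start FG then Max (label_grade FG ` all_labels FG)
      else if derivations FG x = {} then 0
      else Max (deriv_grade FG ` derivations FG x))"

definition cut_language :: "('a, 'l) fuzzy_T0L \<Rightarrow> real \<Rightarrow> 'a list set" where
  "cut_language FG lam = {x \<in> lists (letters FG). string_grade FG x > lam}"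

end

theory Submission imports Defs begin

text \<open>
  A step on a nonempty word has grade exactly the constant of its table, so a derivation has grade
  above the threshold iff each table it applies to a nonempty word has a constant above the threshold.
  Steps on the empty word apply no production and can be dropped.  Hence the cut is generated by the
  tables with constants above the threshold if there are any, and it is empty otherwise.
\<close>

section \<open>Iterated substitutions\<close>

text \<open>A substitution acts on a language word by word, and this passes to iterates.\<close>

lemma mem_foldr_subst_lang_iff:
  "x \<in> foldr subst_lang hs L \<longleftrightarrow> (\<exists>w\<in>L. x \<in> foldr subst_lang hs {w})"
proof (induction hs arbitrary: x)
  case Nil
  then show ?case by simp
next
  case (Cons h hs)
  have "x \<in> foldr subst_lang (h # hs) L \<longleftrightarrow>
      (\<exists>v. v \<in> foldr subst_lang hs L \<and> x \<in> subst_word h v)" for L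
    by (auto simp: subst_lang_def)
  then show ?case
    using Cons.IH by blast
qed

text \<open>The last list entry is innermost in the fold, so it is the first table applied to
  \<open>w\<close>. Peeling it off corresponds to removing the first step of a derivation.\<close>

lemma mem_foldr_subst_lang_snoc_iff:
  "x \<in> foldr subst_lang (hs @ [h]) {w} \<longleftrightarrow>
     (\<exists>v\<in>subst_word h w. x \<in> foldr subst_lang hs {v})"
  using mem_foldr_subst_lang_iff[of x hs "subst_word h w"] by (simp add: subst_lang_def)

lemma subst_word_lists:
  assumes "finite_substitution \<Sigma> h" "w \<in> lists \<Sigma>"
  shows "subst_word h w \<subseteq> lists \<Sigma>"
proof
  fix x assume "x \<in> subst_word h w"
  then obtain us where us: "list_all2 (\<lambda>a u. u \<in> h a) w us" and x: "x = concat us"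
    by (auto simp: subst_word_def)
  from us assms(2) have "concat us \<in> lists \<Sigma>"
    using assms(1) by (induction rule: list_all2_induct) (auto simp: finite_substitution_def)
  then show "x \<in> lists \<Sigma>" using x by simp
qed

lemma T0L_generated_lists:
  assumes "T0L_system \<Sigma> H \<omega>"
  shows "T0L_generated H \<omega> \<subseteq> lists \<Sigma>"
proof -
  have "foldr subst_lang hs {\<omega>} \<subseteq> lists \<Sigma>" if "hs \<in> lists H" for hs
    using that
  proof (induction hs)
    case Nil
    then show ?case using assms by (simp add: T0L_system_def)
  next
    case (Cons h hs)
    then have "finite_substitution \<Sigma> h"
      using assms by (simp add: T0L_system_def)
    with Cons show ?case
      using subst_word_lists by (fastforce simp: subst_lang_def)
  qed
  then show ?thesis
    using assms by (auto simp: T0L_generated_def T0L_system_def)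
qed

lemma mem_T0L_generatedI:
  assumes "hs \<in> lists H" "x \<in> foldr subst_lang hs {\<omega>}"
  shows "x \<in> T0L_generated H \<omega>"
  using assms by (cases "hs = []") (auto simp: T0L_generated_def)

text \<open>With \<Delta> the whole alphabet the intersection removes nothing.\<close>

lemma T0L_language_imp_ET0L_language:
  assumes "T0L_language L"
  shows "ET0L_language L"
  unfolding ET0L_language_def
  using assms T0L_generated_lists by (metis T0L_language_def inf.absorb1 subset_refl)

text \<open>With \<Delta> empty only the empty word could survive. A one-letter system whose only
  production is \<open>a\<close> to \<open>a\<close> never generates it from the axiom
  \<open>[a]\<close>.\<close>

lemma ET0L_language_empty: "ET0L_language ({} :: 'a list set)"
proof -
  fix a :: 'a
  let ?h = "\<lambda>b :: 'a. {[a]}"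
  have sys: "T0L_system {a} {?h} [a]"
    by (simp add: T0L_system_def alphabet_def finite_substitution_def)
  have "[] \<notin> foldr subst_lang hs {[a]}" if "hs \<in> lists {?h}" for hs
    using that
  proof (induction hs)
    case (Cons h hs)
    have "[] \<notin> subst_word ?h w" if "w \<noteq> []" for w
      using that by (cases w) (auto simp: subst_word_def list_all2_Cons1)
    moreover have "h = ?h" using Cons.hyps by simp
    ultimately show ?case
      using Cons by (simp add: subst_lang_def) metis
  qed simp
  then have "T0L_generated {?h} [a] \<inter> lists {} = {}"
    by (auto simp: T0L_generated_def)
  with sys show ?thesis
    unfolding ET0L_language_def by (metis empty_subsetI)
qed

section \<open>Derivations\<close>

text \<open>Zipping a word with the chosen replacements gives a list of productions, and unzipping
  goes back. The alphabet condition on \<open>w\<close> puts the zipped pairs into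
  \<open>productions\<close>.\<close>

lemma mem_subst_word_table_iff:
  assumes "w \<in> lists (letters FG)"
  shows "x \<in> subst_word (table FG i) w \<longleftrightarrow>
    (\<exists>ps. set ps \<subseteq> productions FG i \<and> map fst ps = w \<and> x = concat (map snd ps))"
proof
  assume "x \<in> subst_word (table FG i) w"
  then obtain us where us: "list_all2 (\<lambda>a u. u \<in> table FG i a) w us" and x: "x = concat us"
    by (auto simp: subst_word_def)
  have "length w = length us" "set (zip w us) \<subseteq> productions FG i"
    using us assms by (auto simp: list_all2_iff productions_def dest: set_zip_leftD)
  with x show "\<exists>ps. set ps \<subseteq> productions FG i \<and> map fst ps = w \<and> x = concat (map snd ps)"
    by (intro exI[of _ "zip w us"]) simp
next
  assume "\<exists>ps. set ps \<subseteq> productions FG i \<and> map fst ps = w \<and> x = concat (map snd ps)"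
  then obtain ps where ps: "set ps \<subseteq> productions FG i" "map fst ps = w" "x = concat (map snd ps)"
    by blast
  have "list_all2 (\<lambda>a u. u \<in> table FG i a) (map fst ps) (map snd ps)"
    using ps(1) by (auto simp: list_all2_conv_all_nth productions_def dest!: nth_mem)
  then show "x \<in> subst_word (table FG i) w"
    using ps by (auto simp: subst_word_def)
qed

text \<open>Grades say nothing about the table of a step that applies no production, so
  \<open>I\<close> constrains only the other steps; the former are left out of
  \<open>hs\<close>.\<close>

lemma derives_imp_mem_foldr_subst_lang:
  assumes "\<forall>i\<in>tables FG. finite_substitution (letters FG) (table FG i)"
    and "w \<in> lists (letters FG)" "derives FG w d x"
    and "\<And>i ps. (i, ps) \<in> set d \<Longrightarrow> ps \<noteq> [] \<Longrightarrow> i \<in> I"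
  shows "\<exists>hs\<in>lists (table FG ` (I \<inter> tables FG)). x \<in> foldr subst_lang hs {w}"
  using assms(2-)
proof (induction d arbitrary: w)
  case Nil
  then show ?case by (intro bexI[of _ "[]"]) auto
next
  case (Cons s d)
  obtain i ps where s: "s = (i, ps)" by (cases s)
  let ?v = "concat (map snd ps)"
  have i: "i \<in> tables FG" and ps: "set ps \<subseteq> productions FG i" "map fst ps = w"
    and d: "derives FG ?v d x"
    using Cons.prems(2) s by auto
  have v: "?v \<in> subst_word (table FG i) w"
    using mem_subst_word_table_iff[OF Cons.prems(1)] ps by blast
  then have "?v \<in> lists (letters FG)"
    using subst_word_lists Cons.prems(1) assms(1) i by blast
  with Cons.IH[OF _ d] Cons.prems(3)
  obtain hs where hs: "hs \<in> lists (table FG ` (I \<inter> tables FG))" "x \<in> foldr subst_lang hs {?v}"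
    by auto
  show ?case
  proof (cases "ps = []")
    case True
    \<comment> \<open>Both words are empty, so the list for the remaining steps already
      works.\<close>
    then have "?v = w" using ps by simp
    then show ?thesis using hs by auto
  next
    case False
    then have "i \<in> I" using Cons.prems(3)[of i ps] s by simp
    then show ?thesis
      using hs v i by (intro bexI[of _ "hs @ [table FG i]"])
        (auto simp: mem_foldr_subst_lang_snoc_iff simp del: foldr_append)
  qed
qed

text \<open>The derivation is built from the right end of \<open>hs\<close>, hence the reverse
  induction. Every step, even on the empty word, can use a table from \<open>I\<close>.\<close>

lemma mem_foldr_subst_lang_imp_derives:
  assumes "\<forall>i\<in>tables FG. finite_substitution (letters FG) (table FG i)"
    and "w \<in> lists (letters FG)" "hs \<in> lists (table FG ` (I \<inter> tables FG))"
    and "x \<in> foldr subst_lang hs {w}"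
  shows "\<exists>d. derives FG w d x \<and> fst ` set d \<subseteq> I"
  using assms(2-)
proof (induction hs arbitrary: w rule: rev_induct)
  case Nil
  then show ?case by (intro exI[of _ "[]"]) simp
next
  case (snoc h hs)
  from snoc.prems(2) obtain i where i: "i \<in> I" "i \<in> tables FG" "h = table FG i"
    by auto
  from snoc.prems(3) obtain v where v: "v \<in> subst_word h w" "x \<in> foldr subst_lang hs {v}"
    using mem_foldr_subst_lang_snoc_iff by blast
  have "v \<in> lists (letters FG)"
    using v(1) subst_word_lists snoc.prems(1) assms(1) i by blast
  moreover have "hs \<in> lists (table FG ` (I \<inter> tables FG))"
    using snoc.prems(2) by simp
  ultimately obtain d where d: "derives FG v d x" "fst ` set d \<subseteq> I"
    using snoc.IH v(2) by blast
  from v(1) i(3) obtain ps where "set ps \<subseteq> productions FG i" "map fst ps = w"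
    "v = concat (map snd ps)"
    using mem_subst_word_table_iff[OF snoc.prems(1)] by blast
  with d i show ?case
    by (intro exI[of _ "(i, ps) # d"]) auto
qed

lemma derives_step:
  assumes "derives FG w d x" "(i, ps) \<in> set d"
  shows "i \<in> tables FG" "set ps \<subseteq> productions FG i"
  using assms by (induction FG w d x rule: derives.induct) auto

section \<open>Grades\<close>

lemma finite_applied_labels: "finite (applied_labels FG d)"
  by (auto simp: applied_labels_def)

lemma finite_all_labels: "fuzzy_T0L_system FG \<Longrightarrow> finite (all_labels FG)"
  by (auto simp: fuzzy_T0L_system_def all_labels_def tables_def)

lemma prod_label_mem_labels:
  assumes "fuzzy_T0L_system FG" "derives FG w d x" "(i, ps) \<in> set d" "p \<in> set ps"
  shows "prod_label FG i p \<in> labels FG i"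
  using derives_step[OF assms(2,3)] assms(1,4) by (auto simp: fuzzy_T0L_system_def)

lemma applied_labels_subset:
  assumes "fuzzy_T0L_system FG" "derives FG w d x"
  shows "applied_labels FG d \<subseteq> all_labels FG"
  using prod_label_mem_labels[OF assms] derives_step(1)[OF assms(2)]
  by (fastforce simp: applied_labels_def all_labels_def)

text \<open>Some letter exists and has a production in each table, which needs a label. Thus every
  table contributes to the maximum that grades the axiom.\<close>

lemma labels_nonempty:
  assumes "fuzzy_T0L_system FG" "i \<in> tables FG"
  shows "labels FG i \<noteq> {}"
proof -
  obtain a where a: "a \<in> letters FG"
    using assms(1) by (auto simp: fuzzy_T0L_system_def alphabet_def)
  then obtain u where "u \<in> table FG i a"
    using assms by (fastforce simp: fuzzy_T0L_system_def finite_substitution_def)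
  with a have "(a, u) \<in> productions FG i" by (simp add: productions_def)
  then show ?thesis
    using assms by (auto simp: fuzzy_T0L_system_def)
qed

lemma derives_Nil: "derives FG [] d x \<Longrightarrow> x = []"
  by (induction FG "[] :: 'a list" d x rule: derives.induct) auto

lemma applied_labels_nonempty:
  assumes "d \<in> derivations FG x" "x \<noteq> start FG"
  shows "applied_labels FG d \<noteq> {}"
proof -
  obtain i ps e where d: "d = (i, ps) # e"
    using assms(1) by (auto simp: derivations_def neq_Nil_conv)
  then have "map fst ps = start FG" "derives FG (start FG) d x"
    using assms(1) by (auto simp: derivations_def)
  \<comment> \<open>An empty first step would make the axiom empty, and then \<open>x\<close> would
    be empty too and equal to the axiom.\<close>
  then have "ps \<noteq> []"
    using assms(2) derives_Nil by force
  then show ?thesis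
    by (auto simp: d applied_labels_def)
qed

lemma deriv_grade_greater_iff:
  assumes "d \<in> derivations FG x" "x \<noteq> start FG"
  shows "deriv_grade FG d > lam \<longleftrightarrow> (\<forall>r\<in>applied_labels FG d. label_grade FG r > lam)"
  using applied_labels_nonempty[OF assms] finite_applied_labels[of FG d]
  by (simp add: deriv_grade_def)

lemma string_grade_greater_iff:
  assumes "fuzzy_T0L_system FG" "x \<noteq> start FG" "0 \<le> lam"
  shows "string_grade FG x > lam \<longleftrightarrow>
    (\<exists>d\<in>derivations FG x. \<forall>r\<in>applied_labels FG d. label_grade FG r > lam)"
proof -
  \<comment> \<open>There may be infinitely many derivations, but each grade is the grade of some
    label, so only finitely many values occur and the maximum is meaningful.\<close>
  have "deriv_grade FG d \<in> label_grade FG ` all_labels FG" if "d \<in> derivations FG x" for d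
  proof -
    have "deriv_grade FG d \<in> label_grade FG ` applied_labels FG d"
      unfolding deriv_grade_def
      using applied_labels_nonempty[OF that assms(2)] finite_applied_labels[of FG d]
      by (intro Min_in) auto
    then show ?thesis
      using applied_labels_subset[OF assms(1)] that unfolding derivations_def by blast
  qed
  then have "finite (deriv_grade FG ` derivations FG x)"
    using finite_all_labels[OF assms(1)] by (meson finite_imageI finite_subset image_subsetI)
  \<comment> \<open>If there is no derivation, the default grade 0 does not exceed
    \<open>lam\<close>, by \<open>0 \<le> lam\<close>.\<close>
  then show ?thesis
    using assms(2,3) by (auto simp: string_grade_def Max_gr_iff deriv_grade_greater_iff)
qed

section \<open>Cuts of systems with constant grades on the tables\<close>

lemma cut_language_eq_empty:
  assumes "fuzzy_T0L_system FG" "0 \<le> lam" "\<forall>r\<in>all_labels FG. label_grade FG r \<le> lam"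
  shows "cut_language FG lam = {}"
proof -
  have "all_labels FG \<noteq> {}"
    using labels_nonempty[OF assms(1)] assms(1)
    by (fastforce simp: all_labels_def fuzzy_T0L_system_def tables_def)
  then have "\<not> string_grade FG (start FG) > lam"
    using finite_all_labels[OF assms(1)] assms(3) by (simp add: string_grade_def Max_gr_iff leD)
  moreover have "\<not> string_grade FG x > lam" if x: "x \<noteq> start FG" for x
  proof
    assume "string_grade FG x > lam"
    then obtain d where d: "d \<in> derivations FG x" "\<forall>r\<in>applied_labels FG d. label_grade FG r > lam"
      using string_grade_greater_iff[OF assms(1) x assms(2)] by blast
    \<comment> \<open>One applied label suffices: its grade would have to be above and not above
      \<open>lam\<close>.\<close>
    obtain r where "r \<in> applied_labels FG d"
      using applied_labels_nonempty[OF d(1) x] by blast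
    moreover from this have "r \<in> all_labels FG"
      using applied_labels_subset[OF assms(1)] d(1) by (auto simp: derivations_def)
    ultimately show False
      using d(2) assms(3) by force
  qed
  ultimately have "\<not> string_grade FG x > lam" for x
    by (cases "x = start FG") simp_all
  then show ?thesis
    by (simp add: cut_language_def)
qed

text \<open>\<open>H\<close> keeps the tables with constants above the threshold. That some table
  remains is used twice: a T0L system needs one, and the axiom must lie in the cut.\<close>

lemma cut_language_eq_T0L_generated:
  fixes FG :: "('a, 'l) fuzzy_T0L" and c :: "nat \<Rightarrow> real" and lam :: real
  defines "I \<equiv> {i. c i > lam}"
  defines "H \<equiv> table FG ` (I \<inter> tables FG)"
  assumes sys: "fuzzy_T0L_system FG" and "0 \<le> lam"
    and const: "\<forall>i\<in>tables FG. \<forall>r\<in>labels FG i. label_grade FG r = c i"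
    and ne: "I \<inter> tables FG \<noteq> {}"
  shows "T0L_system (letters FG) H (start FG)"
    and "cut_language FG lam = T0L_generated H (start FG)"
proof -
  have sub: "\<forall>i\<in>tables FG. finite_substitution (letters FG) (table FG i)"
    and start: "start FG \<in> lists (letters FG)"
    using sys by (auto simp: fuzzy_T0L_system_def)
  show T: "T0L_system (letters FG) H (start FG)"
    using sys ne by (auto simp: H_def T0L_system_def fuzzy_T0L_system_def tables_def)
  \<comment> \<open>The axiom is graded by the maximum over all labels, so a single label of one
    remaining table lifts it above \<open>lam\<close>.\<close>
  have start_cut: "string_grade FG (start FG) > lam"
  proof -
    obtain i where i: "i \<in> tables FG" "c i > lam"
      using ne by (auto simp: I_def)
    then obtain r where "r \<in> labels FG i"
      using labels_nonempty[OF sys] by blast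
    with i const have "r \<in> all_labels FG" "label_grade FG r > lam"
      by (auto simp: all_labels_def)
    then show ?thesis
      using finite_all_labels[OF sys] by (auto simp: string_grade_def intro: less_le_trans Max_ge)
  qed
  have "string_grade FG x > lam \<longleftrightarrow> x \<in> T0L_generated H (start FG)" if x: "x \<noteq> start FG" for x
  proof
    assume "string_grade FG x > lam"
    then obtain d where d: "derives FG (start FG) d x"
      and r: "\<forall>r\<in>applied_labels FG d. label_grade FG r > lam"
      using string_grade_greater_iff[OF sys x \<open>0 \<le> lam\<close>] by (auto simp: derivations_def)
    \<comment> \<open>A nonempty step applies some production, and the grade of its label is the
      constant of the table.\<close>
    have "i \<in> I" if "(i, ps) \<in> set d" "ps \<noteq> []" for i ps
    proof -
      obtain p where p: "p \<in> set ps" using \<open>ps \<noteq> []\<close> by (cases ps) auto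
      then have "prod_label FG i p \<in> applied_labels FG d"
        using that by (force simp: applied_labels_def)
      moreover have "label_grade FG (prod_label FG i p) = c i"
        using const derives_step(1)[OF d that(1)] prod_label_mem_labels[OF sys d that(1) p] by blast
      ultimately show ?thesis
        using r by (auto simp: I_def)
    qed
    then show "x \<in> T0L_generated H (start FG)"
      using derives_imp_mem_foldr_subst_lang[OF sub start d, where I = I, folded H_def] mem_T0L_generatedI by metis
  next
    assume "x \<in> T0L_generated H (start FG)"
    then obtain hs where "hs \<in> lists H" "x \<in> foldr subst_lang hs {start FG}"
      using x by (auto simp: T0L_generated_def)
    then obtain d where d: "derives FG (start FG) d x" "fst ` set d \<subseteq> I"
      using mem_foldr_subst_lang_imp_derives[OF sub start, where I = I, folded H_def] by blast
    \<comment> \<open>The empty derivation is excluded because \<open>x\<close> differs from the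
      axiom.\<close>
    then have "d \<in> derivations FG x"
      using x by (auto simp: derivations_def)
    moreover have "label_grade FG r > lam" if r: "r \<in> applied_labels FG d" for r
    proof -
      obtain i ps p where ip: "(i, ps) \<in> set d" "p \<in> set ps" "r = prod_label FG i p"
        using r by (auto simp: applied_labels_def)
      then have "label_grade FG r = c i"
        using const derives_step(1)[OF d(1) ip(1)] prod_label_mem_labels[OF sys d(1) ip(1,2)] by blast
      moreover have "i \<in> I" using d(2) ip(1) by force
      ultimately show ?thesis by (simp add: I_def)
    qed
    ultimately show "string_grade FG x > lam"
      using string_grade_greater_iff[OF sys x \<open>0 \<le> lam\<close>] by blast
  qed
  moreover have "start FG \<in> T0L_generated H (start FG)"
    by (simp add: T0L_generated_def)
  ultimately have "string_grade FG x > lam \<longleftrightarrow> x \<in> T0L_generated H (start FG)" for x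
    using start_cut by (cases "x = start FG") auto
  then show "cut_language FG lam = T0L_generated H (start FG)"
    using T0L_generated_lists[OF T] by (auto simp: cut_language_def simp del: in_lists_conv_set)
qed

text \<open>A T0L language contains its axiom, so the T0L claim is restricted to nonempty cuts. The
  ET0L claim covers both the cut over the whole alphabet and its restriction to words over
  \<Delta>.\<close>

theorem theorem2:
  fixes FG :: "('a, 'l) fuzzy_T0L" and c :: "nat \<Rightarrow> real" and lam :: real
  assumes "\<forall>i\<in>tables FG. 0 \<le> c i \<and> c i \<le> 1 \<and> (\<forall>r\<in>labels FG i. label_grade FG r = c i)"
    and "0 \<le> lam" and "lam < 1"
  shows "(fuzzy_T0L_system FG \<and> cut_language FG lam \<noteq> {} \<longrightarrow>
            T0L_language (cut_language FG lam)) \<and>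
         (\<forall>\<Delta>. fuzzy_ET0L_system FG \<Delta> \<longrightarrow>
            ET0L_language (cut_language FG lam) \<and>
            ET0L_language (cut_language FG lam \<inter> lists \<Delta>))"
proof (cases "{i. c i > lam} \<inter> tables FG = {}")
  case True
  then have "\<forall>i\<in>tables FG. c i \<le> lam"
    by (auto simp: disjoint_iff not_less)
  then have "\<forall>r\<in>all_labels FG. label_grade FG r \<le> lam"
    using assms(1) by (simp add: all_labels_def)
  then have "cut_language FG lam = {}" if "fuzzy_T0L_system FG"
    using cut_language_eq_empty[OF that assms(2)] by blast
  \<comment> \<open>The cut is empty: this contradicts the premise of the T0L claim, and the empty
    language is ET0L.\<close>
  then show ?thesis
    using ET0L_language_empty by (auto simp: fuzzy_ET0L_system_def)
next
  case False
  have gen: "\<exists>H. T0L_system (letters FG) H (start FG) \<and> cut_language FG lam = T0L_generated H (start FG)"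
    if "fuzzy_T0L_system FG"
    using cut_language_eq_T0L_generated[OF that assms(2) _ False] assms(1) by blast
  then have "T0L_language (cut_language FG lam)" if "fuzzy_T0L_system FG"
    using that unfolding T0L_language_def by blast
  \<comment> \<open>The same remaining tables serve; \<Delta> only filters the generated
    words.\<close>
  moreover have "ET0L_language (cut_language FG lam \<inter> lists \<Delta>)" if "fuzzy_ET0L_system FG \<Delta>" for \<Delta>
    using that gen unfolding ET0L_language_def fuzzy_ET0L_system_def by metis
  ultimately show ?thesis
    using T0L_language_imp_ET0L_language by (auto simp: fuzzy_ET0L_system_def)
qed

end
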